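(* For every $k\in\mathbb{N}$ there exists a set $A_k\subset\mathbb{N}$ such that $\{1,\dots,k-1\}\subset A_k$, $k\notin A_k$, $\mathbb{N}\setminus A_k$ is infinite and $\Pr(A_k)$ is finite.
   Context: For $m\in\mathbb{N}$, $D(m)$ is the set of positive divisors of $m$. For $A\subset\mathbb{N}$, $S_A=\sum_{a\in A}a$ ($S_\emptyset=0$), and $A$ is a practical set if every non-negative integer $k\le S_A$ is a sum of distinct elements of $A$. A number $m\in\mathbb{N}$ is $A$-practical if $D(m)\cap A$ is a practical set, and $\Pr(A)$ is the set of all $A$-practical numbers. *)

theory Defs
  imports Main "HOL-Library.Extended_Nat"
begin

text \<open>
  The natural numbers of the source start at 1, so its \<open>\<nat>\<close> is rendered as \<open>{1..} :: nat set\<close>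
  (the set of all \<open>n \<ge> 1\<close>).
\<close>

definition pos_divisors :: "nat \<Rightarrow> nat set" where
  "pos_divisors m = {d. 0 < d \<and> d dvd m}"

text \<open>
  The sum is extended-natural valued because the sum operator of the library is \<open>0\<close> on infinite
  sets, whereas an infinite set of positive integers has sum \<open>\<infinity>\<close>.
\<close>

definition elem_sum :: "nat set \<Rightarrow> enat" where
  "elem_sum A = (if finite A then enat (\<Sum>a\<in>A. a) else \<infinity>)"

text \<open>The empty sum counts as a sum of distinct elements, so the empty set is practical.\<close>

definition practical_set :: "nat set \<Rightarrow> bool" where
  "practical_set A \<longleftrightarrow>
     (\<forall>n::nat. enat n \<le> elem_sum A \<longrightarrow> (\<exists>B. finite B \<and> B \<subseteq> A \<and> n = (\<Sum>b\<in>B. b)))"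

definition is_practical_wrt :: "nat set \<Rightarrow> nat \<Rightarrow> bool" where
  "is_practical_wrt A m \<longleftrightarrow> practical_set (pos_divisors m \<inter> A)"

definition Pr :: "nat set \<Rightarrow> nat set" where
  "Pr A = {m. 1 \<le> m \<and> is_practical_wrt A m}"

end

(* Add to {1,...,k-1} only elements that exceed its sum s by more than 1. If m has a divisor among
   the added elements, then s + 1 is not a sum of distinct divisors of m that lie in A, although
   it is below the total. Adding all n >= s + k + 2 with n mod 4 \<noteq> 2 leaves an infinite complement,
   and still m or m div 2 is an added divisor of every large m. *)
theory Submission
  imports Defs
begin

text \<open>A subset with sum \<open>s + 1\<close> can use only elements of size at most
  \<open>s + 1\<close>, and all of these together reach only \<open>s\<close>. The element
  \<open>d\<close> serves to bring \<open>s + 1\<close> below the total of \<open>D\<close>.\<close>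

lemma not_practical_set_if_gap:
  fixes D :: "nat set" and s d :: nat
  assumes fin: "finite D"
    and small: "\<Sum>{a \<in> D. a \<le> s + 1} \<le> s"
    and d: "d \<in> D" "s + 1 < d"
  shows "\<not> practical_set D"
proof
  assume "practical_set D"
  moreover have "s + 1 \<le> \<Sum>D"
    using member_le_sum[of d D "\<lambda>a. a"] fin d by simp
  ultimately obtain B where B: "B \<subseteq> D" "s + 1 = \<Sum>B"
    using fin unfolding practical_set_def elem_sum_def by (metis enat_ord_simps(1))
  have "finite B"
    using B(1) fin finite_subset by blast
  have "b \<le> s + 1" if "b \<in> B" for b
    using member_le_sum[of b B "\<lambda>a. a"] that \<open>finite B\<close> B(2) by simp
  then have "B \<subseteq> {a \<in> D. a \<le> s + 1}"
    using B(1) by blast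
  then have "\<Sum>B \<le> \<Sum>{a \<in> D. a \<le> s + 1}"
    using fin by (intro sum_mono2) auto
  then show False
    using small B(2) by simp
qed

lemma finite_pos_divisors:
  assumes "0 < m"
  shows "finite (pos_divisors m)"
  unfolding pos_divisors_def using assms by simp

theorem theorem4p5:
  fixes k :: nat
  assumes "1 \<le> k"
  shows "\<exists>A. A \<subseteq> {1..} \<and> {1..k - 1} \<subseteq> A \<and> k \<notin> A \<and> infinite ({1..} - A) \<and> finite (Pr A)"
proof -
  define s where "s = \<Sum>{1..k - 1}"
  \<comment> \<open>The part \<open>s + 2\<close> puts every added element above
    \<open>s + 1\<close>; the part \<open>k\<close> keeps \<open>k\<close> itself from being
    added.\<close>
  define N where "N = s + k + 2"
  define A where "A = {1..k - 1} \<union> {n. N \<le> n \<and> n mod 4 \<noteq> 2}"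
  have "infinite ({1..} - A)"
  proof -
    \<comment> \<open>These numbers are 2 mod 4 and larger than \<open>k - 1\<close>, so they lie in
      neither part of \<open>A\<close>.\<close>
    have "range (\<lambda>j. 4 * (N + j) + 2) \<subseteq> {1..} - A"
      unfolding A_def N_def by (auto; presburger)
    moreover have "inj (\<lambda>j. 4 * (N + j) + 2)"
      by (auto intro: injI)
    ultimately show ?thesis
      using infinite_super range_inj_infinite by blast
  qed
  moreover have "finite (Pr A)"
  proof (rule finite_subset)
    show "Pr A \<subseteq> {..< 2 * N}"
    proof
      fix m assume m: "m \<in> Pr A"
      then have "0 < m" and prac: "practical_set (pos_divisors m \<inter> A)"
        unfolding Pr_def is_practical_wrt_def by auto
      show "m \<in> {..< 2 * N}"
      proof (rule ccontr)
        assume "m \<notin> {..< 2 * N}"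
        then have large: "2 * N \<le> m" by simp
        \<comment> \<open>If \<open>m\<close> is 2 mod 4, its half is odd, hence not 2 mod 4; the
          bound \<open>2 * N\<close> on \<open>m\<close> keeps this half at least
          \<open>N\<close>.\<close>
        obtain d where d: "d dvd m" "N \<le> d" "d mod 4 \<noteq> 2"
        proof (cases "m mod 4 = 2")
          case True
          then have "m = m div 2 * 2" and "m div 2 mod 4 \<noteq> 2"
            by presburger+
          moreover from this(1) have "m div 2 dvd m"
            by (rule dvdI)
          ultimately show ?thesis
            using that[of "m div 2"] large by simp
        next
          case False
          then show ?thesis
            using that[of m] large by simp
        qed
        have "{a \<in> pos_divisors m \<inter> A. a \<le> s + 1} \<subseteq> {1..k - 1}"
          unfolding A_def N_def by auto
        then have "\<Sum>{a \<in> pos_divisors m \<inter> A. a \<le> s + 1} \<le> s"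
          unfolding s_def by (intro sum_mono2) auto
        moreover have "d \<in> pos_divisors m \<inter> A"
          using d \<open>0 < m\<close> unfolding pos_divisors_def A_def by (auto intro: dvd_pos_nat)
        moreover have "s + 1 < d"
          using d(2) unfolding N_def by simp
        ultimately show False
          using not_practical_set_if_gap finite_pos_divisors[OF \<open>0 < m\<close>] prac by blast
      qed
    qed
  qed simp
  moreover have "A \<subseteq> {1..}" "{1..k - 1} \<subseteq> A" "k \<notin> A"
    using assms unfolding A_def N_def by auto
  ultimately show ?thesis
    by blast
qed

end
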